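(* Let $D, K_*, p_1,\dots,p_D \in \mathbb{N}$ and $M, M' > 0$. For $d = 1,\dots,D$ let $f_*^{(d)} : [-M,M]^{p_d} \to [-M',M']^{K_*}$ be continuous functions, and let $g_* : [-M',M']^{K_*} \times [-M',M']^{K_*} \to \mathbb{R}$ be a symmetric, continuous, positive-definite kernel function. Let $\sigma : \mathbb{R} \to \mathbb{R}$ be either the ReLU function $\sigma(t) = \max\{0,t\}$ or a non-constant, continuous, bounded, monotonically increasing function. Then for every $\varepsilon > 0$, for all sufficiently large $K \in \mathbb{N}$ and all sufficiently large $T \in \mathbb{N}$ (where how large $T$ must be may depend on $K$), there exist matrices $\boldsymbol{A}^d \in \mathbb{R}^{K \times T}$, $\boldsymbol{B}^d \in \mathbb{R}^{T \times p_d}$ and vectors $\boldsymbol{c}^d \in \mathbb{R}^T$, $d \in \{1,\dots,D\}$, such that the two-layer neural networks with $T$ hidden units $$f_{\boldsymbol\psi}^{(d)}(\boldsymbol{x}) = \boldsymbol{A}^d\, \boldsymbol{\sigma}(\boldsymbol{B}^d \boldsymbol{x} + \boldsymbol{c}^d), \qquad d = 1,\dots,D,$$ satisfy $$\Big| g_*\big(f_*^{(d)}(\boldsymbol{x}), f_*^{(e)}(\boldsymbol{x}')\big) - \big\langle f_{\boldsymbol\psi}^{(d)}(\boldsymbol{x}), f_{\boldsymbol\psi}^{(e)}(\boldsymbol{x}') \big\rangle \Big| < \varepsilon$$ for all $d, e \in \{1,\dots,D\}$ and all $(\boldsymbol{x},\boldsymbol{x}') \in [-M,M]^{p_d + p_e}$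 (that is, $\boldsymbol{x} \in [-M,M]^{p_d}$, $\boldsymbol{x}' \in [-M,M]^{p_e}$).
   Context: $\langle \cdot,\cdot\rangle$ is the Euclidean inner product on $\mathbb{R}^K$. $\boldsymbol{\sigma}$ denotes the function $\sigma$ applied to each coordinate of a vector. A symmetric kernel $g_*$ is positive definite in the usual sense of kernel methods (Mercer's theorem): $\sum_{i,j=1}^{m} c_i c_j\, g_*(\boldsymbol{y}_i,\boldsymbol{y}_j) \ge 0$ for all $m \in \mathbb{N}$, all $c_1,\dots,c_m \in \mathbb{R}$ and all $\boldsymbol{y}_1,\dots,\boldsymbol{y}_m \in [-M',M']^{K_*}$. *)

theory Defs
  imports "HOL-Analysis.Analysis" "Jordan_Normal_Form.Matrix"
begin

text \<open>
  The dimensions p d, K and T vary inside the statement, so points of the cubes are functions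
  on {..<n}, extended by the value undefined. On cubes of such functions the product topology of
  the type nat => real induces the Euclidean topology, hence continuous_on has its usual
  meaning. Parameters and outputs of the networks are matrices and vectors with
  carrier dimensions.
\<close>

definition cube :: "nat \<Rightarrow> real \<Rightarrow> (nat \<Rightarrow> real) set" where
  "cube n r = {..<n} \<rightarrow>\<^sub>E {- r..r}"

text \<open>Positive definiteness as in Mercer's theorem: the sums are only required to be nonnegative.\<close>

definition positive_definite_kernel_on ::
    "'a set \<Rightarrow> ('a \<Rightarrow> 'a \<Rightarrow> real) \<Rightarrow> bool" where
  "positive_definite_kernel_on S g \<longleftrightarrow>
     (\<forall>(m::nat) (c::nat \<Rightarrow> real) (y::nat \<Rightarrow> 'a). (\<forall>i\<in>{1..m}. y i \<in> S) \<longrightarrow>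
        0 \<le> (\<Sum>i=1..m. \<Sum>j=1..m. c i * c j * g (y i) (y j)))"

definition relu :: "real \<Rightarrow> real" where
  "relu t = max 0 t"

definition two_layer_network ::
    "(real \<Rightarrow> real) \<Rightarrow> real mat \<Rightarrow> real mat \<Rightarrow> real Matrix.vec \<Rightarrow> real Matrix.vec \<Rightarrow> real Matrix.vec" where
  "two_layer_network \<sigma> A B c x = A *\<^sub>v map_vec \<sigma> (B *\<^sub>v x + c)"

end

theory Submission imports Defs begin

text \<open>
  Subtracting \<open>g x z * g y z / g z z\<close> from a positive definite kernel \<open>g\<close> leaves a positive
  definite kernel whose diagonal vanishes at \<open>z\<close>. After doing this for all points \<open>z\<close> of a
  sufficiently fine finite net, the remaining kernel is uniformly small, because the subtractions
  decrease the squared kernel distance \<open>g x x - 2 * g x z + g z z\<close> of \<open>x\<close> to a net point. This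
  replaces Mercer's theorem: \<open>g\<close> is uniformly close to \<open>\<Sum>k<m. \<phi> k x * \<phi> k y\<close> with continuous
  features \<open>\<phi> k\<close>, and it remains to approximate each \<open>\<phi> k \<circ> f_star d\<close> by a network. By
  Stone-Weierstrass the exponentials of affine forms span a dense space, and the
  exponential function on an interval is a uniform limit of staircases built from shifted and
  rescaled copies of a sigmoidal function in the span of the activation function.
\<close>

subsection \<open>Finite rank approximation of positive definite kernels\<close>

text \<open>A nonnegative real quadratic form does not force its kernel to be symmetric, so both
  properties are bundled; Schur complements preserve them together.\<close>

definition symmetric_psd_kernel_on :: "'a set \<Rightarrow> ('a \<Rightarrow> 'a \<Rightarrow> real) \<Rightarrow> bool" where
  "symmetric_psd_kernel_on S g \<longleftrightarrow>
     positive_definite_kernel_on S g \<and> (\<forall>x\<in>S. \<forall>y\<in>S. g x y = g y x)"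

lemma symmetric_psd_kernel_on_commute:
  "symmetric_psd_kernel_on S g \<Longrightarrow> x \<in> S \<Longrightarrow> y \<in> S \<Longrightarrow> g x y = g y x"
  by (simp add: symmetric_psd_kernel_on_def)

text \<open>Suitable choices of \<open>a\<close> and \<open>b\<close> take the place of the
  Cauchy-Schwarz inequality below.\<close>

lemma symmetric_psd_kernel_on_two_points:
  assumes "symmetric_psd_kernel_on S g" "x \<in> S" "y \<in> S"
  shows "0 \<le> a\<^sup>2 * g x x + 2 * a * b * g x y + b\<^sup>2 * g y y"
proof -
  define c where "c = (\<lambda>i::nat. if i = 1 then a else b)"
  define u where "u = (\<lambda>i::nat. if i = 1 then x else y)"
  have "0 \<le> (\<Sum>i=1..2::nat. \<Sum>j=1..2::nat. c i * c j * g (u i) (u j))"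
    using assms unfolding symmetric_psd_kernel_on_def positive_definite_kernel_on_def
    by (auto simp: u_def)
  also have "\<dots> = a\<^sup>2 * g x x + 2 * a * b * g x y + b\<^sup>2 * g y y"
    using symmetric_psd_kernel_on_commute[OF assms]
    by (simp add: c_def u_def numeral_2_eq_2 algebra_simps)
  finally show ?thesis .
qed

lemma symmetric_psd_kernel_on_diag_nonneg:
  assumes "symmetric_psd_kernel_on S g" "x \<in> S"
  shows "0 \<le> g x x"
  using symmetric_psd_kernel_on_two_points[OF assms assms(2), of 1 0] by simp

text \<open>If \<open>g z z = 0\<close>, the two-point form with \<open>a = 1\<close> is affine in
  \<open>b\<close> with slope \<open>2 * g x z\<close>; being bounded below, it must be
  constant.\<close>

lemma symmetric_psd_kernel_on_null:
  assumes g: "symmetric_psd_kernel_on S g" and "x \<in> S" "z \<in> S" and z: "g z z = 0"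
  shows "g x z = 0"
proof (rule ccontr)
  assume nz: "g x z \<noteq> 0"
  \<comment> \<open>With this choice of \<open>b\<close> the form would take the value
    \<open>-1\<close>.\<close>
  have "0 \<le> 1\<^sup>2 * g x x + 2 * 1 * (- (g x x + 1) / (2 * g x z)) * g x z
      + (- (g x x + 1) / (2 * g x z))\<^sup>2 * g z z"
    by (rule symmetric_psd_kernel_on_two_points) fact+
  then show False
    using nz z by (simp add: field_simps)
qed

text \<open>Taking \<open>a = 1\<close> with \<open>b = 1\<close> and \<open>b = -1\<close> gives
  \<open>2 * \<bar>g x y\<bar> \<le> g x x + g y y\<close>, so a bound on the diagonal controls the
  whole kernel.\<close>

lemma symmetric_psd_kernel_on_abs_le:
  assumes "symmetric_psd_kernel_on S g" "x \<in> S" "y \<in> S" "g x x \<le> r" "g y y \<le> r"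
  shows "\<bar>g x y\<bar> \<le> r"
  using symmetric_psd_kernel_on_two_points[OF assms(1-3), of 1 1]
    symmetric_psd_kernel_on_two_points[OF assms(1-3), of 1 "-1"] assms(4,5)
  by simp

text \<open>The Schur complement; if \<open>g z z = 0\<close>, then division by zero makes it equal to \<open>g\<close>.\<close>

lemma symmetric_psd_kernel_on_schur:
  assumes g: "symmetric_psd_kernel_on S g" and z: "z \<in> S"
  shows "symmetric_psd_kernel_on S (\<lambda>x y. g x y - g x z * g y z / g z z)"
proof (cases "g z z = 0")
  case True
  then show ?thesis using g by simp
next
  case False
  have "0 \<le> (\<Sum>i=1..m. \<Sum>j=1..m. c i * c j * (g (y i) (y j) - g (y i) z * g (y j) z / g z z))"
    if y: "\<forall>i\<in>{1..m}. y i \<in> S" for m :: nat and c and y :: "nat \<Rightarrow> 'a"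
  proof -
    define s where "s = (\<Sum>i=1..m. c i * g (y i) z)"
    \<comment> \<open>The coefficient \<open>- s / g z z\<close> of the additional point
      \<open>z\<close> minimises the quadratic form in that coefficient; the minimum is the form of
      the Schur complement at the original points.\<close>
    define c' where "c' = c(Suc m := - s / g z z)"
    define y' where "y' = y(Suc m := z)"
    have "\<forall>i\<in>{1..Suc m}. y' i \<in> S"
      using y z by (auto simp: y'_def)
    then have "0 \<le> (\<Sum>i=1..Suc m. \<Sum>j=1..Suc m. c' i * c' j * g (y' i) (y' j))"
      using g unfolding symmetric_psd_kernel_on_def positive_definite_kernel_on_def by blast
    also have "\<dots> = (\<Sum>i=1..m. \<Sum>j=1..m. c' i * c' j * g (y' i) (y' j))
        + (\<Sum>i=1..m. c' i * c' (Suc m) * g (y' i) (y' (Suc m)))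
        + (\<Sum>j=1..m. c' (Suc m) * c' j * g (y' (Suc m)) (y' j))
        + c' (Suc m) * c' (Suc m) * g (y' (Suc m)) (y' (Suc m))"
      by (simp add: sum.distrib)
    also have "(\<Sum>i=1..m. \<Sum>j=1..m. c' i * c' j * g (y' i) (y' j))
        = (\<Sum>i=1..m. \<Sum>j=1..m. c i * c j * g (y i) (y j))"
      by (intro sum.cong) (auto simp: c'_def y'_def)
    also have "(\<Sum>i=1..m. c' i * c' (Suc m) * g (y' i) (y' (Suc m))) = - s / g z z * s"
      unfolding s_def sum_distrib_left
      by (intro sum.cong) (auto simp: c'_def y'_def s_def)
    also have "(\<Sum>j=1..m. c' (Suc m) * c' j * g (y' (Suc m)) (y' j)) = - s / g z z * s"
      unfolding s_def sum_distrib_left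
      using y z symmetric_psd_kernel_on_commute[OF g]
      by (intro sum.cong) (auto simp: c'_def y'_def s_def)
    also have "c' (Suc m) * c' (Suc m) * g (y' (Suc m)) (y' (Suc m)) = s * s / g z z"
      using False by (simp add: c'_def y'_def)
    also have "(\<Sum>i=1..m. \<Sum>j=1..m. c i * c j * g (y i) (y j)) + - s / g z z * s + - s / g z z * s
        + s * s / g z z = (\<Sum>i=1..m. \<Sum>j=1..m. c i * c j * g (y i) (y j)) - s * s / g z z"
      by simp
    also have "s * s / g z z
        = (\<Sum>i=1..m. \<Sum>j=1..m. c i * c j * (g (y i) z * g (y j) z / g z z))"
      unfolding s_def sum_product sum_divide_distrib
      by (intro sum.cong) (auto simp: field_simps)
    finally show ?thesis
      by (simp add: right_diff_distrib sum_subtractf)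
  qed
  then show ?thesis
    using symmetric_psd_kernel_on_commute[OF g]
    unfolding symmetric_psd_kernel_on_def positive_definite_kernel_on_def
    by (simp add: mult.commute)
qed

text \<open>Each net point contributes one feature, a normalised column of the current remainder, so
  that the new remainder is a Schur complement of the old one. Zeros already reached on the diagonal
  persist.\<close>

lemma psd_kernel_interpolation:
  fixes g :: "'a::topological_space \<Rightarrow> 'a \<Rightarrow> real"
  assumes "finite Z" "Z \<subseteq> S" and g: "symmetric_psd_kernel_on S g"
    and cont: "\<And>z. z \<in> S \<Longrightarrow> continuous_on S (\<lambda>x. g x z)"
  shows "\<exists>m \<phi>. (\<forall>k::nat. continuous_on S (\<phi> k)) \<and>
    symmetric_psd_kernel_on S (\<lambda>x y. g x y - (\<Sum>k<m. \<phi> k x * \<phi> k y)) \<and>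
    (\<forall>z\<in>Z. g z z - (\<Sum>k<m. \<phi> k z * \<phi> k z) = 0)"
  using assms(1,2)
proof (induction Z rule: finite_induct)
  case empty
  then show ?case
    using g by (auto intro!: exI[of _ 0] exI[of _ "\<lambda>_ _. 0"])
next
  case (insert z Z)
  then obtain m and \<phi> :: "nat \<Rightarrow> 'a \<Rightarrow> real" where
    \<phi>: "\<And>k. continuous_on S (\<phi> k)"
      and r: "symmetric_psd_kernel_on S (\<lambda>x y. g x y - (\<Sum>k<m. \<phi> k x * \<phi> k y))"
      and 0: "\<And>w. w \<in> Z \<Longrightarrow> g w w - (\<Sum>k<m. \<phi> k w * \<phi> k w) = 0"
    by blast
  have z: "z \<in> S"
    using insert by simp
  define r where "r = (\<lambda>x y. g x y - (\<Sum>k<m. \<phi> k x * \<phi> k y))"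
  \<comment> \<open>\<open>\<psi> m x * \<psi> m y\<close> is the term that the Schur complement
    subtracts. If \<open>r z z = 0\<close>, division by zero makes this feature zero and the
    remainder stays the same.\<close>
  define \<psi> where "\<psi> = \<phi>(m := \<lambda>x. r x z / sqrt (r z z))"
  have r': "symmetric_psd_kernel_on S r"
    using r by (simp add: r_def)
  have nonneg: "r x x \<ge> 0" if "x \<in> S" for x
    by (rule symmetric_psd_kernel_on_diag_nonneg[OF r' that])
  have sum_\<psi>: "g x y - (\<Sum>k<Suc m. \<psi> k x * \<psi> k y) = r x y - r x z * r y z / r z z" for x y
    using nonneg[OF z] by (simp add: \<psi>_def r_def)
  have schur: "symmetric_psd_kernel_on S (\<lambda>x y. r x y - r x z * r y z / r z z)"
    by (rule symmetric_psd_kernel_on_schur[OF r' z])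
  have "continuous_on S (\<psi> k)" for k
    unfolding \<psi>_def r_def fun_upd_def
    by (cases "k = m") (use \<phi> cont z in \<open>auto simp: divide_inverse intro!: continuous_intros\<close>)
  \<comment> \<open>At an earlier net point \<open>r w w = 0\<close> forces
    \<open>r w z = 0\<close>, so the new term changes nothing there.\<close>
  moreover have "r w w - r w z * r w z / r z z = 0" if "w \<in> insert z Z" for w
  proof (cases "w = z")
    case False
    then have "w \<in> S" "r w w = 0"
      using that insert 0 by (auto simp: r_def)
    then show ?thesis
      using symmetric_psd_kernel_on_null[OF r' z, of w]
        symmetric_psd_kernel_on_commute[OF r' z, of w] by simp
  qed auto
  ultimately show ?case
    using schur by (intro exI[of _ "Suc m"] exI[of _ \<psi>]) (auto simp only: sum_\<psi>)
qed

text \<open>Only the diagonal of the remainder has to be made small. Continuity of \<open>g\<close>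
  makes the sets of points close to a net point relatively open, and compactness then supplies a
  finite net.\<close>

lemma psd_kernel_finite_rank_approximation:
  fixes g :: "'a::topological_space \<Rightarrow> 'a \<Rightarrow> real"
  assumes "compact S" and g: "symmetric_psd_kernel_on S g"
    and cont: "continuous_on (S \<times> S) (\<lambda>(x, y). g x y)" and "\<epsilon> > 0"
  shows "\<exists>m \<phi>. (\<forall>k::nat. continuous_on S (\<phi> k)) \<and>
    (\<forall>x\<in>S. \<forall>y\<in>S. \<bar>g x y - (\<Sum>k<m. \<phi> k x * \<phi> k y)\<bar> < \<epsilon>)"
proof -
  define \<eta> where "\<eta> = \<epsilon> / 2"
  have "\<eta> > 0" "\<eta> < \<epsilon>"
    using \<open>\<epsilon> > 0\<close> by (auto simp: \<eta>_def)
  have cont': "continuous_on S (\<lambda>x. g (u x) (v x))"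
    if "continuous_on S u" "continuous_on S v" "u ` S \<subseteq> S" "v ` S \<subseteq> S" for u v
    using continuous_on_compose2[OF cont, of S "\<lambda>x. (u x, v x)"] that
    by (auto intro!: continuous_intros)
  \<comment> \<open>\<open>N z\<close> is the ball around \<open>z\<close> of squared radius \<eta>
    in the pseudometric induced by \<open>g\<close>.\<close>
  define N where "N z = {x \<in> S. g x x - 2 * g x z + g z z < \<eta>}" for z
  have "openin (top_of_set S) (N z)" if "z \<in> S" for z
  proof -
    have "continuous_on S (\<lambda>x. g x x - 2 * g x z + g z z)"
      using that by (intro continuous_intros cont') auto
    from continuous_openin_preimage_gen[OF this open_lessThan[of \<eta>]]
    show ?thesis
      by (simp add: N_def vimage_def Int_def)
  qed
  moreover have "S \<subseteq> \<Union> (N ` S)"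
    using \<open>\<eta> > 0\<close> by (force simp: N_def)
  ultimately obtain D where "D \<subseteq> N ` S" "finite D" "S \<subseteq> \<Union>D"
    using \<open>compact S\<close> unfolding compact_eq_openin_cover by (metis imageE)
  then obtain Z where Z: "Z \<subseteq> S" "finite Z" "S \<subseteq> \<Union> (N ` Z)"
    by (metis finite_subset_image)
  have "\<exists>m \<phi>. (\<forall>k::nat. continuous_on S (\<phi> k)) \<and>
    symmetric_psd_kernel_on S (\<lambda>x y. g x y - (\<Sum>k<m. \<phi> k x * \<phi> k y)) \<and>
    (\<forall>z\<in>Z. g z z - (\<Sum>k<m. \<phi> k z * \<phi> k z) = 0)"
    by (intro psd_kernel_interpolation Z g cont' continuous_intros) auto
  then obtain m and \<phi> :: "nat \<Rightarrow> 'a \<Rightarrow> real" where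
    \<phi>: "\<And>k. continuous_on S (\<phi> k)"
      and "symmetric_psd_kernel_on S (\<lambda>x y. g x y - (\<Sum>k<m. \<phi> k x * \<phi> k y))"
      and "\<And>z. z \<in> Z \<Longrightarrow> g z z - (\<Sum>k<m. \<phi> k z * \<phi> k z) = 0"
    by blast
  define r where "r = (\<lambda>x y. g x y - (\<Sum>k<m. \<phi> k x * \<phi> k y))"
  have r: "symmetric_psd_kernel_on S r" and r0: "\<And>z. z \<in> Z \<Longrightarrow> r z z = 0"
    unfolding r_def by fact+
  have "r x x \<le> \<eta>" if "x \<in> S" for x
  proof -
    obtain z where z: "z \<in> Z" "x \<in> N z"
      using Z \<open>x \<in> S\<close> by blast
    then have "r x z = 0"
      using Z that by (intro symmetric_psd_kernel_on_null[OF r _ _ r0]) auto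
    \<comment> \<open>The two added terms vanish; they turn the diagonal value into a squared kernel
      distance, where the features enter through a sum of squares.\<close>
    then have "r x x = r x x - 2 * r x z + r z z"
      using r0[OF z(1)] by simp
    also have "\<dots> = g x x - 2 * g x z + g z z - (\<Sum>k<m. (\<phi> k x - \<phi> k z)\<^sup>2)"
      by (simp add: r_def power2_eq_square algebra_simps sum.distrib sum_subtractf sum_distrib_left)
    also have "\<dots> \<le> g x x - 2 * g x z + g z z"
      by (simp add: sum_nonneg)
    also have "\<dots> \<le> \<eta>"
      using z by (simp add: N_def)
    finally show ?thesis .
  qed
  then have "\<bar>r x y\<bar> \<le> \<eta>" if "x \<in> S" "y \<in> S" for x y
    using that by (intro symmetric_psd_kernel_on_abs_le[OF r])
  then show ?thesis
    using \<phi> \<open>\<eta> < \<epsilon>\<close> by (intro exI[of _ m] exI[of _ \<phi>]) (force simp: r_def)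
qed

subsection \<open>Universal approximation by two-layer networks\<close>

text \<open>With the factor \<open>{undefined}\<close> at every coordinate from \<open>n\<close> on,
  the cube is a full product of compact sets, and Tychonoff's theorem applies.\<close>

lemma compact_cube: "compact (cube n r)"
proof -
  have "x \<in> cube n r \<longleftrightarrow> (\<forall>i. x i \<in> (if i < n then {- r..r} else {undefined}))" for x
  proof -
    have "x \<in> cube n r \<longleftrightarrow> (\<forall>i. (i < n \<longrightarrow> x i \<in> {- r..r}) \<and> (\<not> i < n \<longrightarrow> x i \<in> {undefined}))"
      unfolding cube_def PiE_iff extensional_def mem_Collect_eq lessThan_iff singleton_iff by blast
    then show ?thesis
      by (simp only: if_split)
  qed
  then have "cube n r = PiE UNIV (\<lambda>i. if i < n then {- r..r} else {undefined})"
    by (simp add: set_eq_iff PiE_UNIV_domain Pi_iff)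
  then have "compactin (product_topology (\<lambda>i. euclidean) UNIV) (cube n r)"
    by (simp add: compactin_PiE)
  then show ?thesis
    by (simp add: euclidean_product_topology)
qed

lemma continuous_on_affine_form:
  "continuous_on S (\<lambda>x::nat \<Rightarrow> real. (\<Sum>j<n. b j * x j) + c)"
  by (intro continuous_intros continuous_on_product_then_coordinatewise continuous_on_id)

text \<open>The spaces of two-layer networks with scalar output and any number of hidden units.\<close>

inductive_set ridge_span ::
    "(real \<Rightarrow> real) \<Rightarrow> nat \<Rightarrow> ((nat \<Rightarrow> real) \<Rightarrow> real) set"
  for \<sigma> :: "real \<Rightarrow> real" and n :: nat where
  ridge: "(\<lambda>x. \<sigma> ((\<Sum>j<n. b j * x j) + c)) \<in> ridge_span \<sigma> n"
| scale: "f \<in> ridge_span \<sigma> n \<Longrightarrow> (\<lambda>x. a * f x) \<in> ridge_span \<sigma> n"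
| add: "f \<in> ridge_span \<sigma> n \<Longrightarrow> g \<in> ridge_span \<sigma> n \<Longrightarrow> (\<lambda>x. f x + g x) \<in> ridge_span \<sigma> n"

section \<open>Closure properties of ridge spans and density of exponentials\<close>

lemma ridge_span_zero: "(\<lambda>x. 0) \<in> ridge_span \<sigma> n"
  using ridge_span.scale[OF ridge_span.ridge, of 0] by simp

lemma ridge_span_sum:
  assumes "finite I" "\<And>i. i \<in> I \<Longrightarrow> f i \<in> ridge_span \<sigma> n"
  shows "(\<lambda>x. \<Sum>i\<in>I. f i x) \<in> ridge_span \<sigma> n"
  using assms by (induction I rule: finite_induct) (auto intro: ridge_span_zero ridge_span.add)

text \<open>The networks have no output bias; a hidden unit with zero weights and a nonzero value
  supplies the constants.\<close>

lemma ridge_span_const: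
  assumes "\<sigma> t \<noteq> 0"
  shows "(\<lambda>x. c) \<in> ridge_span \<sigma> n"
  using ridge_span.scale[OF ridge_span.ridge[of \<sigma> "\<lambda>_. 0" n t], of "c / \<sigma> t"] assms by simp

text \<open>A product of exponentials of affine forms is the exponential of their sum, and
  bilinearity extends this to the span. This is the algebra property for Stone-Weierstrass.\<close>

lemma ridge_span_exp_mult:
  assumes "f \<in> ridge_span exp n" "g \<in> ridge_span exp n"
  shows "(\<lambda>x. f x * g x) \<in> ridge_span exp n"
  using assms
proof (induction f)
  case (ridge b c)
  from ridge show ?case
  proof (induction g)
    case (ridge b' c')
    show ?case
      using ridge_span.ridge[of exp "\<lambda>j. b j + b' j" n "c + c'"]
      by (simp add: algebra_simps sum.distrib flip: exp_add)
  qed (auto simp: distrib_left mult.left_commute intro: ridge_span.scale ridge_span.add)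
qed (auto simp: distrib_right mult.assoc intro: ridge_span.scale ridge_span.add)

lemma ridge_span_exp_dense:
  assumes "continuous_on (cube n r) h" "\<epsilon> > 0"
  shows "\<exists>f\<in>ridge_span exp n. \<forall>x\<in>cube n r. \<bar>h x - f x\<bar> < \<epsilon>"
proof -
  interpret function_ring_on "ridge_span exp n" "cube n r"
  proof
    show "continuous_on (cube n r) f" if "f \<in> ridge_span exp n" for f
      using that by induction (auto intro!: continuous_intros continuous_on_affine_form)
    show "\<exists>f\<in>ridge_span exp n. f x \<noteq> f y"
      if "x \<in> cube n r" "y \<in> cube n r" "x \<noteq> y" for x y
    proof -
      \<comment> \<open>Outside \<open>{..<n}\<close> both points are \<open>undefined\<close>, so
        distinct points differ at some coordinate below \<open>n\<close>.\<close>
      have "x = y" if "\<And>j. j < n \<Longrightarrow> x j = y j"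
        using \<open>x \<in> cube n r\<close> \<open>y \<in> cube n r\<close> unfolding cube_def
        by (rule PiE_ext) (simp add: that)
      then obtain j where j: "j < n" "x j \<noteq> y j"
        using \<open>x \<noteq> y\<close> by metis
      have "(\<Sum>i<n. (if i = j then 1 else 0) * w i) = w j" for w :: "nat \<Rightarrow> real"
      proof -
        have "(\<Sum>i<n. (if i = j then 1 else 0) * w i) = (\<Sum>i<n. if i = j then w i else 0)"
          by (intro sum.cong) auto
        also have "\<dots> = w j"
          by (subst sum.delta) (use j(1) in auto)
        finally show ?thesis .
      qed
      \<comment> \<open>Unit weights select the coordinate \<open>j\<close>, and \<open>exp\<close>
        is injective.\<close>
      then have "(\<lambda>x. exp (x j)) \<in> ridge_span exp n"
        using ridge_span.ridge[of exp "\<lambda>i. if i = j then 1 else 0" n 0] by simp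
      then show ?thesis
        by (rule bexI[rotated]) (use j(2) in simp)
    qed
  qed (simp_all add: compact_cube ridge_span.add ridge_span_exp_mult ridge_span_const[of exp 0])
  show ?thesis
    using Stone_Weierstrass_basic[OF assms] .
qed

section \<open>From exponentials to sigmoidal functions\<close>

text \<open>Uniform approximability passes to linear combinations, so only the generating ridge
  functions have to be treated.\<close>

lemma ridge_span_approx_mono:
  assumes f: "f \<in> ridge_span \<sigma> n"
    and approx: "\<And>b c \<epsilon>. \<epsilon> > 0 \<Longrightarrow>
      \<exists>k\<in>ridge_span \<tau> n. \<forall>x\<in>S. \<bar>\<sigma> ((\<Sum>j<n. b j * x j) + c) - k x\<bar> < \<epsilon>"
    and "\<epsilon> > 0"
  shows "\<exists>k\<in>ridge_span \<tau> n. \<forall>x\<in>S. \<bar>f x - k x\<bar> < \<epsilon>"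
  using f \<open>\<epsilon> > 0\<close>
proof (induction f arbitrary: \<epsilon>)
  case (ridge b c)
  then show ?case by (rule approx)
next
  case (scale f a)
  \<comment> \<open>The summand \<open>1\<close> covers \<open>a = 0\<close> and makes the final
    bound strict.\<close>
  define \<delta> where "\<delta> = \<epsilon> / (\<bar>a\<bar> + 1)"
  have "\<delta> > 0"
    using scale.prems by (simp add: \<delta>_def)
  then obtain k where k: "k \<in> ridge_span \<tau> n" "\<And>x. x \<in> S \<Longrightarrow> \<bar>f x - k x\<bar> < \<delta>"
    using scale.IH by blast
  have "\<bar>a * f x - a * k x\<bar> < \<epsilon>" if "x \<in> S" for x
  proof -
    have "\<bar>a * f x - a * k x\<bar> = \<bar>a\<bar> * \<bar>f x - k x\<bar>"
      by (simp add: abs_mult flip: right_diff_distrib)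
    also have "\<dots> \<le> \<bar>a\<bar> * \<delta>"
      using k(2)[OF that] by (intro mult_left_mono) auto
    also have "\<dots> < \<epsilon>"
      using scale.prems by (simp add: \<delta>_def field_simps)
    finally show ?thesis .
  qed
  then show ?case
    by (intro bexI[OF _ ridge_span.scale[OF k(1), of a]]) simp
next
  case (add f g)
  have "\<epsilon> / 2 > 0"
    using add.prems by simp
  then obtain k l where kl: "k \<in> ridge_span \<tau> n" "l \<in> ridge_span \<tau> n"
    "\<And>x. x \<in> S \<Longrightarrow> \<bar>f x - k x\<bar> < \<epsilon> / 2" "\<And>x. x \<in> S \<Longrightarrow> \<bar>g x - l x\<bar> < \<epsilon> / 2"
    using add.IH by meson
  have "\<bar>f x + g x - (k x + l x)\<bar> < \<epsilon>" if "x \<in> S" for x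
    using kl(3,4)[OF that] by linarith
  then show ?case
    by (intro bexI[OF _ ridge_span.add[OF kl(1,2)]]) simp
qed

text \<open>The partial increments \<open>I i\<close> of \<open>h\<close> up to \<open>x\<close> add up to \<open>h x - h \<alpha>\<close>, and each of
  them is close to a full increment times \<open>s\<close>, except for the at most two \<open>i\<close> with
  \<open>\<bar>x - t i\<bar> < \<delta>\<close>, for which the increment itself is small.\<close>

lemma mono_on_sigmoidal_approximation:
  fixes h s :: "real \<Rightarrow> real"
  assumes cont: "continuous_on {\<alpha>..\<beta>} h" and h: "mono_on {\<alpha>..\<beta>} h" and "\<alpha> < \<beta>"
    and s: "\<And>t. 0 \<le> s t" "\<And>t. s t \<le> 1" "(s \<longlongrightarrow> 0) at_bot" "(s \<longlongrightarrow> 1) at_top"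
    and "\<epsilon> > 0"
  shows "\<exists>N a l \<tau>. \<forall>x\<in>{\<alpha>..\<beta>}. \<bar>h x - (h \<alpha> + (\<Sum>i<N::nat. a i * s (l * (x - \<tau> i))))\<bar> < \<epsilon>"
proof -
  define V where "V = h \<beta> - h \<alpha>"
  \<comment> \<open>The error budget: the regular terms contribute at most
    \<open>V * \<eta> \<le> \<epsilon> / 4\<close> and the two exceptional ones at most
    \<open>\<epsilon> / 4\<close> each. The \<open>1\<close> in the denominator covers constant
    \<open>h\<close>.\<close>
  define \<eta> where "\<eta> = \<epsilon> / (4 * (V + 1))"
  have "V \<ge> 0"
    using mono_onD[OF h, of \<alpha> \<beta>] \<open>\<alpha> < \<beta>\<close> by (simp add: V_def)
  then have "\<eta> > 0" and \<eta>V: "\<eta> * V \<le> \<epsilon> / 4"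
    using \<open>\<epsilon> > 0\<close> by (auto simp: \<eta>_def field_simps)
  obtain \<delta>0 where "\<delta>0 > 0" and \<delta>0:
    "\<And>x y. x \<in> {\<alpha>..\<beta>} \<Longrightarrow> y \<in> {\<alpha>..\<beta>} \<Longrightarrow> \<bar>y - x\<bar> < \<delta>0 \<Longrightarrow> \<bar>h y - h x\<bar> < \<epsilon> / 4"
    using compact_uniformly_continuous[OF cont] \<open>\<epsilon> > 0\<close>
    unfolding uniformly_continuous_on_def dist_real_def
    by (metis compact_Icc zero_less_divide_iff zero_less_numeral)
  obtain N :: nat where N: "(\<beta> - \<alpha>) / \<delta>0 < N"
    using reals_Archimedean2 by blast
  moreover have "(\<beta> - \<alpha>) / \<delta>0 > 0"
    using \<open>\<alpha> < \<beta>\<close> \<open>\<delta>0 > 0\<close> by simp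
  ultimately have "N > 0"
    by (metis less_trans of_nat_0_less_iff)
  define \<delta> where "\<delta> = (\<beta> - \<alpha>) / N"
  have "\<delta> > 0" "\<delta> < \<delta>0"
    using N \<open>N > 0\<close> \<open>\<alpha> < \<beta>\<close> \<open>\<delta>0 > 0\<close> by (auto simp: \<delta>_def field_simps)
  define t where "t i = \<alpha> + real i * \<delta>" for i
  have t0: "t 0 = \<alpha>" and tN: "t N = \<beta>" and tSuc: "\<And>i. t (Suc i) = t i + \<delta>"
    using \<open>N > 0\<close> by (simp_all add: t_def \<delta>_def distrib_right add_divide_distrib)
  have t_in: "t i \<in> {\<alpha>..\<beta>}" if "i \<le> N" for i
  proof -
    have "real i * \<delta> \<le> real N * \<delta>"
      using that \<open>\<delta> > 0\<close> by (intro mult_right_mono) auto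
    then have "t i \<le> t N"
      by (simp add: t_def)
    moreover have "\<alpha> \<le> t i"
      using \<open>\<delta> > 0\<close> by (simp add: t_def)
    ultimately show ?thesis
      by (simp add: tN)
  qed
  define a where "a i = h (t (Suc i)) - h (t i)" for i
  have a: "0 \<le> a i" "a i \<le> \<epsilon> / 4" if "i < N" for i
    using mono_onD[OF h t_in[of i] t_in[of "Suc i"]] \<delta>0[OF t_in[of i] t_in[of "Suc i"]] that
      \<open>\<delta> > 0\<close> \<open>\<delta> < \<delta>0\<close> by (auto simp: a_def tSuc)
  have "\<forall>\<^sub>F u in at_bot. s u < \<eta>" "\<forall>\<^sub>F u in at_top. s u > 1 - \<eta>"
    using order_tendstoD(2)[OF s(3)] order_tendstoD(1)[OF s(4)] \<open>\<eta> > 0\<close> by auto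
  then obtain L1 L2 where L1: "\<And>u. u \<le> L1 \<Longrightarrow> s u < \<eta>" and L2: "\<And>u. u \<ge> L2 \<Longrightarrow> s u > 1 - \<eta>"
    unfolding eventually_at_bot_linorder eventually_at_top_linorder by auto
  define L where "L = max 0 (max (- L1) L2)"
  have "- L \<le> L1" "L2 \<le> L"
    by (auto simp: L_def)
  \<comment> \<open>At distance at least \<delta> from \<open>t i\<close>, the argument
    \<open>l * (x - t i)\<close> lies outside the open interval from \<open>- L\<close> to
    \<open>L\<close>, where \<open>s\<close> is within \<eta> of its limits.\<close>
  define l where "l = L / \<delta>"
  have "l \<ge> 0" and l: "l * \<delta> = L"
    using \<open>\<delta> > 0\<close> by (auto simp: l_def L_def)
  have "\<bar>h x - (h \<alpha> + (\<Sum>i<N. a i * s (l * (x - t i))))\<bar> < \<epsilon>" if x: "x \<in> {\<alpha>..\<beta>}" for x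
  proof -
    define I where "I i = h (min x (t (Suc i))) - h (min x (t i))" for i
    define C where "C = {i. i < N \<and> \<bar>x - t i\<bar> < \<delta>}"
    have sumI: "(\<Sum>i<N. I i) = h x - h \<alpha>"
      using sum_lessThan_telescope[of "\<lambda>i. h (min x (t i))" N] x
      by (simp add: I_def t0 tN)
    have I: "0 \<le> I i" "I i \<le> a i" if "i < N" for i
    proof -
      consider "x \<le> t i" | "t i \<le> x" "x \<le> t (Suc i)" | "t (Suc i) \<le> x"
        by linarith
      then show "0 \<le> I i" "I i \<le> a i"
        using mono_onD[OF h t_in[of i] x] mono_onD[OF h x t_in[of "Suc i"]] that
          a(1)[OF that] \<open>\<delta> > 0\<close>
        by (cases; auto simp: I_def a_def tSuc min_def)+
    qed
    have term_le: "\<bar>I i - a i * s (l * (x - t i))\<bar> \<le> a i * \<eta> + (if i \<in> C then \<epsilon> / 4 else 0)"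
      if "i < N" for i
    proof -
      have as: "0 \<le> a i * s (l * (x - t i))" "a i * s (l * (x - t i)) \<le> a i"
        using s(1,2) a(1)[OF that] by (auto intro: mult_left_le)
      consider "i \<in> C" | "x - t i \<ge> \<delta>" | "x - t i \<le> - \<delta>"
        using \<open>i < N\<close> by (force simp: C_def)
      then show ?thesis
      proof cases
        \<comment> \<open>Both \<open>I i\<close> and the step term lie between \<open>0\<close> and
          \<open>a i\<close>, which is at most \<open>\<epsilon> / 4\<close>.\<close>
        case 1
        have "0 \<le> a i * \<eta>"
          using a(1)[OF that] \<open>\<eta> > 0\<close> by simp
        with 1 I[OF that] a[OF that] as show ?thesis
          by (simp only: if_True abs_le_iff) linarith
      next
        case 2
        then have "t i \<le> x" "t (Suc i) \<le> x"
          using \<open>\<delta> > 0\<close> by (simp_all add: tSuc)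
        then have "I i = a i"
          by (simp add: I_def a_def min_absorb2)
        have "l * \<delta> \<le> l * (x - t i)"
          using 2 \<open>l \<ge> 0\<close> by (rule mult_left_mono)
        then have "1 - s (l * (x - t i)) \<le> \<eta>"
          using L2[of "l * (x - t i)"] \<open>L2 \<le> L\<close> by (simp add: l)
        then have "a i * (1 - s (l * (x - t i))) \<le> a i * \<eta>"
          using a(1)[OF that] by (rule mult_left_mono)
        then show ?thesis
          using \<open>I i = a i\<close> as by (simp add: right_diff_distrib) (use \<open>\<epsilon> > 0\<close> in linarith)
      next
        case 3
        then have "x \<le> t i" "x \<le> t (Suc i)"
          using \<open>\<delta> > 0\<close> by (simp_all add: tSuc)
        then have "I i = 0"
          by (simp add: I_def min_absorb1)
        have "l * (x - t i) \<le> l * (- \<delta>)"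
          using 3 \<open>l \<ge> 0\<close> by (rule mult_left_mono)
        then have "s (l * (x - t i)) \<le> \<eta>"
          using L1[of "l * (x - t i)"] \<open>- L \<le> L1\<close> by (simp add: l)
        then have "a i * s (l * (x - t i)) \<le> a i * \<eta>"
          using a(1)[OF that] by (rule mult_left_mono)
        then show ?thesis
          using \<open>I i = 0\<close> as by simp (use \<open>\<epsilon> > 0\<close> in linarith)
      qed
    qed
    \<comment> \<open>Membership in \<open>C\<close> says that \<open>i\<close> differs from
      \<open>(x - \<alpha>) / \<delta>\<close> by less than one.\<close>
    have "C \<subseteq> {nat \<lfloor>(x - \<alpha>) / \<delta>\<rfloor>, Suc (nat \<lfloor>(x - \<alpha>) / \<delta>\<rfloor>)}"
    proof
      fix i
      assume "i \<in> C"
      then have "real i < (x - \<alpha>) / \<delta> + 1" "(x - \<alpha>) / \<delta> < real i + 1"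
        using \<open>\<delta> > 0\<close> by (auto simp: C_def t_def field_simps abs_less_iff)
      then have "int i \<le> \<lfloor>(x - \<alpha>) / \<delta>\<rfloor> + 1" "\<lfloor>(x - \<alpha>) / \<delta>\<rfloor> \<le> int i"
        by linarith+
      then show "i \<in> {nat \<lfloor>(x - \<alpha>) / \<delta>\<rfloor>, Suc (nat \<lfloor>(x - \<alpha>) / \<delta>\<rfloor>)}"
        by auto
    qed
    then have "card C \<le> card {nat \<lfloor>(x - \<alpha>) / \<delta>\<rfloor>, Suc (nat \<lfloor>(x - \<alpha>) / \<delta>\<rfloor>)}"
      by (intro card_mono) auto
    then have "card C \<le> 2"
      by simp
    have "\<bar>h x - (h \<alpha> + (\<Sum>i<N. a i * s (l * (x - t i))))\<bar>
        = \<bar>\<Sum>i<N. I i - a i * s (l * (x - t i))\<bar>"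
      using sumI by (simp add: sum_subtractf algebra_simps)
    also have "\<dots> \<le> (\<Sum>i<N. \<bar>I i - a i * s (l * (x - t i))\<bar>)"
      by (rule sum_abs)
    also have "\<dots> \<le> (\<Sum>i<N. a i * \<eta> + (if i \<in> C then \<epsilon> / 4 else 0))"
      by (intro sum_mono term_le) simp
    also have "\<dots> = (\<Sum>i<N. a i) * \<eta> + (\<Sum>i<N. if i \<in> C then \<epsilon> / 4 else 0)"
      by (simp add: sum.distrib sum_distrib_right)
    also have "(\<Sum>i<N. a i) = V"
      using sum_lessThan_telescope[of "\<lambda>i. h (t i)" N] by (simp add: a_def V_def t0 tN)
    also have "(\<Sum>i<N. if i \<in> C then \<epsilon> / 4 else 0) = (\<Sum>i\<in>C. \<epsilon> / 4)"
      by (rule sum.mono_neutral_cong_right) (auto simp: C_def)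
    also have "(\<Sum>i\<in>C. \<epsilon> / 4) \<le> 2 * (\<epsilon> / 4)"
      using \<open>card C \<le> 2\<close> \<open>\<epsilon> > 0\<close> by simp
    also have "V * \<eta> + 2 * (\<epsilon> / 4) < \<epsilon>"
      using \<eta>V \<open>\<epsilon> > 0\<close> by (simp add: mult.commute)
    finally show ?thesis
      by simp
  qed
  then show ?thesis
    by blast
qed

text \<open>An affine form maps the compact cube into some interval \<open>{- R..R}\<close>.
  Composing a staircase for \<open>exp\<close> on this interval with the form gives a sum of ridge
  functions of \<open>s\<close> and a constant.\<close>

lemma ridge_span_sigmoidal_approximates_exp:
  assumes f: "f \<in> ridge_span exp n"
    and s: "\<And>t. 0 \<le> s t" "\<And>t. s t \<le> 1" "(s \<longlongrightarrow> 0) at_bot" "(s \<longlongrightarrow> 1) at_top"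
    and "\<epsilon> > 0"
  shows "\<exists>k\<in>ridge_span s n. \<forall>x\<in>cube n r. \<bar>f x - k x\<bar> < \<epsilon>"
  using f
proof (rule ridge_span_approx_mono)
  fix b :: "nat \<Rightarrow> real" and c \<epsilon> :: real
  assume "\<epsilon> > 0"
  define w where "w x = (\<Sum>j<n. b j * x j) + c" for x
  have "compact (w ` cube n r)"
    unfolding w_def by (intro compact_continuous_image continuous_on_affine_form compact_cube)
  then have "bounded (w ` cube n r)"
    by (rule compact_imp_bounded)
  then obtain R where "R > 0" and R: "\<And>x. x \<in> cube n r \<Longrightarrow> \<bar>w x\<bar> \<le> R"
    unfolding bounded_pos by auto
  have "\<exists>N a l \<tau>. \<forall>y\<in>{- R..R}.
      \<bar>exp y - (exp (- R) + (\<Sum>i<N::nat. a i * s (l * (y - \<tau> i))))\<bar> < \<epsilon>"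
    using \<open>R > 0\<close> \<open>\<epsilon> > 0\<close>
    by (intro mono_on_sigmoidal_approximation s continuous_intros) (auto intro: mono_onI)
  then obtain N :: nat and a l \<tau> where approx: "\<And>y. y \<in> {- R..R} \<Longrightarrow>
      \<bar>exp y - (exp (- R) + (\<Sum>i<N. a i * s (l * (y - \<tau> i))))\<bar> < \<epsilon>"
    by blast
  define k where "k x = exp (- R) + (\<Sum>i<N. a i * s (l * (w x - \<tau> i)))" for x
  \<comment> \<open>A nonzero value of \<open>s\<close> puts the constant \<open>exp (- R)\<close>
    into the span.\<close>
  have "\<forall>\<^sub>F t in at_top. s t > 0"
    using order_tendstoD(1)[OF s(4), of 0] by simp
  then obtain t where "s t \<noteq> 0"
    by (metis eventually_happens less_irrefl trivial_limit_at_top_linorder)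
  moreover have "(\<lambda>x. s (l * (w x - \<tau> i))) \<in> ridge_span s n" for i
    using ridge_span.ridge[of s "\<lambda>j. l * b j" n "l * (c - \<tau> i)"]
    by (simp add: w_def algebra_simps sum_distrib_left)
  ultimately have "k \<in> ridge_span s n"
    unfolding k_def
    by (intro ridge_span.add[OF ridge_span_const[of s t]] ridge_span_sum ridge_span.scale) auto
  moreover have "\<bar>exp (w x) - k x\<bar> < \<epsilon>" if "x \<in> cube n r" for x
    using approx[of "w x"] R[OF that] by (simp add: k_def abs_le_iff)
  ultimately show "\<exists>k\<in>ridge_span s n. \<forall>x\<in>cube n r. \<bar>exp ((\<Sum>j<n. b j * x j) + c) - k x\<bar> < \<epsilon>"
    unfolding w_def by blast
qed fact

section \<open>Sigmoidal functions in the spans of the activation functions\<close>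

lemma ridge_span_subset:
  assumes "\<And>b c. (\<lambda>x. s ((\<Sum>j<n. b j * x j) + c)) \<in> ridge_span \<sigma> n"
  shows "ridge_span s n \<subseteq> ridge_span \<sigma> n"
proof
  show "f \<in> ridge_span \<sigma> n" if "f \<in> ridge_span s n" for f
    using that by induction (auto intro: assms ridge_span.scale ridge_span.add)
qed

text \<open>The difference of two shifted ReLUs is a ramp that is \<open>0\<close> up to
  \<open>0\<close> and \<open>1\<close> from \<open>1\<close> on.\<close>

lemma relu_sigmoidal:
  "\<exists>s. (\<forall>t. 0 \<le> s t \<and> s t \<le> 1) \<and> (s \<longlongrightarrow> 0) at_bot \<and> (s \<longlongrightarrow> 1) at_top \<and>
     ridge_span s n \<subseteq> ridge_span relu n"
proof (intro exI conjI)
  let ?s = "\<lambda>t. relu t - relu (t - 1)"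
  show "\<forall>t. 0 \<le> ?s t \<and> ?s t \<le> 1"
    by (auto simp: relu_def)
  have "\<forall>\<^sub>F t in at_bot. ?s t = 0"
    using eventually_le_at_bot[of 0] by eventually_elim (simp add: relu_def)
  then show "(?s \<longlongrightarrow> 0) at_bot"
    by (rule tendsto_eventually)
  have "\<forall>\<^sub>F t in at_top. ?s t = 1"
    using eventually_ge_at_top[of 1] by eventually_elim (simp add: relu_def)
  then show "(?s \<longlongrightarrow> 1) at_top"
    by (rule tendsto_eventually)
  show "ridge_span ?s n \<subseteq> ridge_span relu n"
  proof (rule ridge_span_subset)
    fix b c
    show "(\<lambda>x. ?s ((\<Sum>j<n. b j * x j) + c)) \<in> ridge_span relu n"
      using ridge_span.add[OF ridge_span.ridge[of relu b n c]
          ridge_span.scale[OF ridge_span.ridge[of relu b n "c - 1"], of "-1"]]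
      by (simp add: algebra_simps)
  qed
qed

text \<open>By monotonicity \<sigma> tends to its infimum and supremum at the two ends; an affine
  normalisation moves these limits to \<open>0\<close> and \<open>1\<close>.\<close>

lemma bounded_mono_sigmoidal:
  fixes \<sigma> :: "real \<Rightarrow> real"
  assumes nc: "\<not> \<sigma> constant_on UNIV" and "bounded (range \<sigma>)" and "mono \<sigma>"
  shows "\<exists>s. (\<forall>t. 0 \<le> s t \<and> s t \<le> 1) \<and> (s \<longlongrightarrow> 0) at_bot \<and> (s \<longlongrightarrow> 1) at_top \<and>
    ridge_span s n \<subseteq> ridge_span \<sigma> n"
proof -
  define a where "a = Inf (range \<sigma>)"
  define b where "b = Sup (range \<sigma>)"
  have bdd: "bdd_above (range \<sigma>)" "bdd_below (range \<sigma>)"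
    using \<open>bounded (range \<sigma>)\<close> by (auto intro: bounded_imp_bdd_above bounded_imp_bdd_below)
  have ab: "a \<le> \<sigma> t" "\<sigma> t \<le> b" for t
    unfolding a_def b_def using bdd by (auto intro: cInf_lower cSup_upper)
  have "a \<noteq> b"
    using nc ab unfolding constant_on_def by (metis order_antisym)
  then have "a < b"
    using ab[of 0] by linarith
  have top: "(\<sigma> \<longlongrightarrow> b) at_top"
  proof (rule increasing_tendsto)
    fix y
    assume "y < b"
    then obtain t where t: "y < \<sigma> t"
      unfolding b_def using less_cSup_iff[of "range \<sigma>" y] bdd by auto
    show "\<forall>\<^sub>F u in at_top. y < \<sigma> u"
      using eventually_ge_at_top[of t]
      by eventually_elim (use t monoD[OF \<open>mono \<sigma>\<close>] in \<open>force intro: less_le_trans\<close>)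
  qed (simp add: ab)
  have bot: "(\<sigma> \<longlongrightarrow> a) at_bot"
  proof (rule decreasing_tendsto)
    fix y
    assume "a < y"
    then obtain t where t: "\<sigma> t < y"
      unfolding a_def using cInf_less_iff[of "range \<sigma>" y] bdd by auto
    show "\<forall>\<^sub>F u in at_bot. \<sigma> u < y"
      using eventually_le_at_bot[of t]
      by eventually_elim (use t monoD[OF \<open>mono \<sigma>\<close>] in \<open>force intro: le_less_trans\<close>)
  qed (simp add: ab)
  \<comment> \<open>This value provides the constant \<open>- a\<close> of the
    normalisation.\<close>
  obtain t where "\<sigma> t \<noteq> 0"
    using nc unfolding constant_on_def by metis
  let ?s = "\<lambda>t. (\<sigma> t - a) / (b - a)"
  show ?thesis
  proof (intro exI conjI)
    show "\<forall>t. 0 \<le> ?s t \<and> ?s t \<le> 1"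
      using ab \<open>a < b\<close> by simp
    show "(?s \<longlongrightarrow> 0) at_bot"
      by (rule tendsto_eq_intros bot refl | use \<open>a < b\<close> in simp)+
    show "(?s \<longlongrightarrow> 1) at_top"
      by (rule tendsto_eq_intros top refl | use \<open>a < b\<close> in simp)+
    show "ridge_span ?s n \<subseteq> ridge_span \<sigma> n"
    proof (rule ridge_span_subset)
      fix w c
      show "(\<lambda>x. ?s ((\<Sum>j<n. w j * x j) + c)) \<in> ridge_span \<sigma> n"
        using ridge_span.scale[OF ridge_span.add[OF ridge_span.ridge[of \<sigma> w n c]
              ridge_span_const[of \<sigma> t "- a" n, OF \<open>\<sigma> t \<noteq> 0\<close>]], of "1 / (b - a)"]
        by simp
    qed
  qed
qed

lemma ridge_span_dense:
  assumes "\<sigma> = relu \<or> (\<not> \<sigma> constant_on UNIV \<and> bounded (range \<sigma>) \<and> mono \<sigma>)"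
    and h: "continuous_on (cube n r) h" and "\<epsilon> > 0"
  shows "\<exists>f\<in>ridge_span \<sigma> n. \<forall>x\<in>cube n r. \<bar>h x - f x\<bar> < \<epsilon>"
proof -
  have "\<exists>s. (\<forall>t. 0 \<le> s t \<and> s t \<le> 1) \<and> (s \<longlongrightarrow> 0) at_bot \<and> (s \<longlongrightarrow> 1) at_top \<and>
    ridge_span s n \<subseteq> ridge_span \<sigma> n"
    using assms(1) relu_sigmoidal bounded_mono_sigmoidal by metis
  then obtain s where s: "\<And>t. 0 \<le> s t" "\<And>t. s t \<le> 1" "(s \<longlongrightarrow> 0) at_bot" "(s \<longlongrightarrow> 1) at_top"
    and sub: "ridge_span s n \<subseteq> ridge_span \<sigma> n"
    by blast
  have "\<epsilon> / 2 > 0"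
    using \<open>\<epsilon> > 0\<close> by simp
  obtain f where f: "f \<in> ridge_span exp n" "\<forall>x\<in>cube n r. \<bar>h x - f x\<bar> < \<epsilon> / 2"
    using ridge_span_exp_dense[OF h \<open>\<epsilon> / 2 > 0\<close>] by blast
  obtain k where k: "k \<in> ridge_span s n" "\<forall>x\<in>cube n r. \<bar>f x - k x\<bar> < \<epsilon> / 2"
    using ridge_span_sigmoidal_approximates_exp[OF f(1) s \<open>\<epsilon> / 2 > 0\<close>] by blast
  have "\<bar>h x - k x\<bar> < \<epsilon>" if "x \<in> cube n r" for x
    using f(2)[rule_format, OF that] k(2)[rule_format, OF that] by linarith
  then show ?thesis
    using k(1) sub by blast
qed

section \<open>From ridge spans to weight matrices\<close>

text \<open>Hidden units are indexed by their own weights and bias. Allowing every finite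
  \<open>U\<close> above \<open>W\<close> lets several representations share one index set, both for
  sums and for networks with several outputs.\<close>

lemma ridge_span_parameters:
  assumes "f \<in> ridge_span \<sigma> n"
  shows "\<exists>W a. finite W \<and> (\<forall>U x. finite U \<and> W \<subseteq> U \<longrightarrow>
    f x = (\<Sum>w\<in>U. a w * \<sigma> ((\<Sum>j<n. fst w j * x j) + snd w)))"
  using assms
proof induction
  case (ridge b c)
  have "\<sigma> ((\<Sum>j<n. b j * x j) + c)
      = (\<Sum>w\<in>U. (if w = (b, c) then 1 else 0) * \<sigma> ((\<Sum>j<n. fst w j * x j) + snd w))"
    if "finite U" "{(b, c)} \<subseteq> U" for U x
  proof -
    have "(\<Sum>w\<in>U. (if w = (b, c) then 1 else 0) * \<sigma> ((\<Sum>j<n. fst w j * x j) + snd w))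
        = (\<Sum>w\<in>{(b, c)}. \<sigma> ((\<Sum>j<n. fst w j * x j) + snd w))"
      using that by (intro sum.mono_neutral_cong_right) auto
    then show ?thesis
      by simp
  qed
  then show ?case
    by (intro exI[of _ "{(b, c)}"] exI[of _ "\<lambda>w. if w = (b, c) then 1 else 0"]) blast
next
  case (scale f u)
  then obtain W a where "finite W" "\<And>U x. finite U \<and> W \<subseteq> U \<Longrightarrow>
    f x = (\<Sum>w\<in>U. a w * \<sigma> ((\<Sum>j<n. fst w j * x j) + snd w))"
    by blast
  then show ?case
    by (intro exI[of _ W] exI[of _ "\<lambda>w. u * a w"]) (simp add: sum_distrib_left mult.assoc)
next
  case (add f g)
  obtain W a where "finite W" and f: "\<And>U x. finite U \<and> W \<subseteq> U \<Longrightarrow>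
      f x = (\<Sum>w\<in>U. a w * \<sigma> ((\<Sum>j<n. fst w j * x j) + snd w))"
    using add.IH(1) by blast
  moreover obtain W' a' where "finite W'" and g: "\<And>U x. finite U \<and> W' \<subseteq> U \<Longrightarrow>
      g x = (\<Sum>w\<in>U. a' w * \<sigma> ((\<Sum>j<n. fst w j * x j) + snd w))"
    using add.IH(2) by blast
  ultimately show ?case
    by (intro exI[of _ "W \<union> W'"] exI[of _ "\<lambda>w. a w + a' w"])
      (auto simp: distrib_right sum.distrib intro!: arg_cong2[where f = "(+)"] f g)
qed

lemma ridge_span_two_layer_network:
  assumes "\<And>k. k < K \<Longrightarrow> f k \<in> ridge_span \<sigma> n"
  shows "\<forall>\<^sub>F T in sequentially. \<exists>A\<in>carrier_mat K T. \<exists>B\<in>carrier_mat T n. \<exists>c\<in>carrier_vec T.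
    \<forall>x. \<forall>k<K. vec_index (two_layer_network \<sigma> A B c (Matrix.vec n x)) k = f k x"
proof -
  define P where "P k W a \<longleftrightarrow> finite W \<and> (\<forall>U x. finite U \<and> W \<subseteq> U \<longrightarrow>
    f k x = (\<Sum>w\<in>U. a w * \<sigma> ((\<Sum>j<n. fst w j * x j) + snd w)))" for k W a
  have "\<exists>W a. P k W a" if "k < K" for k
    unfolding P_def by (rule ridge_span_parameters[OF assms[OF that]])
  then obtain W a where Wa: "\<And>k. k < K \<Longrightarrow> P k (W k) (a k)"
    by metis
  have W: "finite (W k)" if "k < K" for k
    using Wa[OF that] by (simp add: P_def)
  have f: "f k x = (\<Sum>w\<in>U. a k w * \<sigma> ((\<Sum>j<n. fst w j * x j) + snd w))"
    if "k < K" "finite U" "W k \<subseteq> U" for k U x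
    using Wa[OF that(1)] that(2,3) by (simp add: P_def)
  \<comment> \<open>All outputs share this hidden layer.\<close>
  define U where "U = (\<Union>k<K. W k)"
  have "finite U"
    using W by (simp add: U_def)
  then obtain e where e: "bij_betw e {0..<card U} U"
    using ex_bij_betw_nat_finite by blast
  have "\<exists>A\<in>carrier_mat K T. \<exists>B\<in>carrier_mat T n. \<exists>c\<in>carrier_vec T.
    \<forall>x. \<forall>k<K. vec_index (two_layer_network \<sigma> A B c (Matrix.vec n x)) k = f k x"
    if T: "T \<ge> card U" for T
  proof (intro bexI allI impI)
    \<comment> \<open>Zero columns of \<open>?A\<close> silence the units from \<open>card U\<close>
      on, where \<open>e\<close> is unspecified; this realises every larger
      \<open>T\<close>.\<close>
    let ?A = "Matrix.mat K T (\<lambda>(k, i). if i < card U then a k (e i) else 0)"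
    let ?B = "Matrix.mat T n (\<lambda>(i, j). fst (e i) j)"
    let ?c = "Matrix.vec T (\<lambda>i. snd (e i))"
    fix x :: "nat \<Rightarrow> real" and k
    assume "k < K"
    define F where "F w = \<sigma> ((\<Sum>j<n. fst w j * x j) + snd w)" for w
    have "vec_index (two_layer_network \<sigma> ?A ?B ?c (Matrix.vec n x)) k
        = (\<Sum>i = 0..<T. (if i < card U then a k (e i) else 0) * F (e i))"
      using \<open>k < K\<close>
      by (simp add: two_layer_network_def scalar_prod_def F_def atLeast0LessThan)
    also have "\<dots> = (\<Sum>i = 0..<card U. a k (e i) * F (e i))"
      using T by (intro sum.mono_neutral_cong_right) auto
    also have "\<dots> = (\<Sum>w\<in>U. a k w * F w)"
      by (rule sum.reindex_bij_betw[OF e])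
    also have "\<dots> = f k x"
      unfolding F_def using \<open>k < K\<close> \<open>finite U\<close> by (intro f[symmetric]) (auto simp: U_def)
    finally show "vec_index (two_layer_network \<sigma> ?A ?B ?c (Matrix.vec n x)) k = f k x" .
  qed auto
  then show ?thesis
    by (rule eventually_sequentiallyI)
qed

lemma two_layer_network_universal_approximation:
  assumes "\<sigma> = relu \<or> (\<not> \<sigma> constant_on UNIV \<and> bounded (range \<sigma>) \<and> mono \<sigma>)"
    and "\<And>k. k < K \<Longrightarrow> continuous_on (cube n r) (h k)" and "\<epsilon> > 0"
  shows "\<forall>\<^sub>F T in sequentially. \<exists>A\<in>carrier_mat K T. \<exists>B\<in>carrier_mat T n. \<exists>c\<in>carrier_vec T.
    \<forall>x\<in>cube n r. \<forall>k<K.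
      \<bar>h k x - vec_index (two_layer_network \<sigma> A B c (Matrix.vec n x)) k\<bar> < \<epsilon>"
proof -
  have "\<exists>f. k < K \<longrightarrow> f \<in> ridge_span \<sigma> n \<and> (\<forall>x\<in>cube n r. \<bar>h k x - f x\<bar> < \<epsilon>)" for k
    using ridge_span_dense[OF assms(1) assms(2) \<open>\<epsilon> > 0\<close>, of k] by blast
  then obtain f where f: "\<And>k. k < K \<Longrightarrow> f k \<in> ridge_span \<sigma> n"
    "\<And>k x. k < K \<Longrightarrow> x \<in> cube n r \<Longrightarrow> \<bar>h k x - f k x\<bar> < \<epsilon>"
    by metis
  have "\<forall>\<^sub>F T in sequentially. \<exists>A\<in>carrier_mat K T. \<exists>B\<in>carrier_mat T n. \<exists>c\<in>carrier_vec T.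
      \<forall>x. \<forall>k<K. vec_index (two_layer_network \<sigma> A B c (Matrix.vec n x)) k = f k x"
    using f(1) by (rule ridge_span_two_layer_network)
  then show ?thesis
  proof eventually_elim
    case (elim T)
    then obtain A B c where "A \<in> carrier_mat K T" "B \<in> carrier_mat T n" "c \<in> carrier_vec T"
      and "\<And>x k. k < K \<Longrightarrow> vec_index (two_layer_network \<sigma> A B c (Matrix.vec n x)) k = f k x"
      by blast
    then show ?case
      using f(2) by (intro bexI[of _ A] bexI[of _ B] bexI[of _ c]) auto
  qed
qed

subsection \<open>Approximation of the kernel\<close>

text \<open>The splitting \<open>(a - u) * b + u * (b - v)\<close> works with
  \<open>\<bar>u\<bar> \<le> C + 1\<close>, which follows from
  \<open>\<delta> \<le> 1\<close>.\<close>

lemma abs_mult_diff_le: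
  fixes a b u v :: real
  assumes "\<bar>a\<bar> \<le> C" "\<bar>b\<bar> \<le> C" "\<bar>a - u\<bar> \<le> \<delta>" "\<bar>b - v\<bar> \<le> \<delta>" "\<delta> \<le> 1"
  shows "\<bar>a * b - u * v\<bar> \<le> \<delta> * (2 * C + 1)"
proof -
  have "\<bar>a * b - u * v\<bar> = \<bar>(a - u) * b + u * (b - v)\<bar>"
    by (simp add: algebra_simps)
  also have "\<dots> \<le> \<bar>a - u\<bar> * \<bar>b\<bar> + \<bar>u\<bar> * \<bar>b - v\<bar>"
    by (metis abs_mult abs_triangle_ineq)
  also have "\<dots> \<le> \<delta> * C + (C + 1) * \<delta>"
    using assms by (intro add_mono mult_mono) auto
  finally show ?thesis
    by (simp add: algebra_simps)
qed

theorem theorem5p1: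
  fixes D K_star :: nat
    and p :: "nat \<Rightarrow> nat"
    and M M' :: real
    and f_star :: "nat \<Rightarrow> (nat \<Rightarrow> real) \<Rightarrow> (nat \<Rightarrow> real)"
    and g_star :: "(nat \<Rightarrow> real) \<Rightarrow> (nat \<Rightarrow> real) \<Rightarrow> real"
    and \<sigma> :: "real \<Rightarrow> real"
  assumes "M > 0" and "M' > 0"
    and "\<And>d. d \<in> {1..D} \<Longrightarrow> f_star d \<in> cube (p d) M \<rightarrow> cube K_star M'"
    and "\<And>d. d \<in> {1..D} \<Longrightarrow> continuous_on (cube (p d) M) (f_star d)"
    and "\<And>y y'. y \<in> cube K_star M' \<Longrightarrow> y' \<in> cube K_star M' \<Longrightarrow> g_star y y' = g_star y' y"
    and "continuous_on (cube K_star M' \<times> cube K_star M') (\<lambda>(y, y'). g_star y y')"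
    and "positive_definite_kernel_on (cube K_star M') g_star"
    and "\<sigma> = relu \<or>
         (\<not> \<sigma> constant_on UNIV \<and> continuous_on UNIV \<sigma> \<and> bounded (range \<sigma>) \<and> mono \<sigma>)"
  shows "\<forall>\<epsilon>>0. \<forall>\<^sub>F K in sequentially. \<forall>\<^sub>F T in sequentially.
    \<exists>(A :: nat \<Rightarrow> real mat) (B :: nat \<Rightarrow> real mat) (c :: nat \<Rightarrow> real Matrix.vec).
      (\<forall>d\<in>{1..D}. A d \<in> carrier_mat K T \<and> B d \<in> carrier_mat T (p d) \<and> c d \<in> carrier_vec T) \<and>
      (\<forall>d\<in>{1..D}. \<forall>e\<in>{1..D}. \<forall>x\<in>cube (p d) M. \<forall>x'\<in>cube (p e) M.
         \<bar>g_star (f_star d x) (f_star e x') -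
          scalar_prod
            (two_layer_network \<sigma> (A d) (B d) (c d) (Matrix.vec (p d) x))
            (two_layer_network \<sigma> (A e) (B e) (c e) (Matrix.vec (p e) x'))\<bar> < \<epsilon>)"
proof (intro allI impI)
  fix \<epsilon> :: real
  assume "\<epsilon> > 0"
  let ?Y = "cube K_star M'"
  have g: "symmetric_psd_kernel_on ?Y g_star"
    using assms(5,7) by (simp add: symmetric_psd_kernel_on_def)
  have "\<epsilon> / 2 > 0"
    using \<open>\<epsilon> > 0\<close> by simp
  then obtain m and \<phi> :: "nat \<Rightarrow> (nat \<Rightarrow> real) \<Rightarrow> real" where \<phi>: "\<And>k. continuous_on ?Y (\<phi> k)"
    and g_\<phi>: "\<And>y y'. y \<in> ?Y \<Longrightarrow> y' \<in> ?Y \<Longrightarrow> \<bar>g_star y y' - (\<Sum>k<m. \<phi> k y * \<phi> k y')\<bar> < \<epsilon> / 2"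
    using psd_kernel_finite_rank_approximation[OF compact_cube g assms(6)] by blast
  have "bounded (\<Union>k<m. \<phi> k ` ?Y)"
    using \<phi> by (intro bounded_UN) (auto intro!: compact_imp_bounded compact_continuous_image compact_cube)
  then obtain C where "C > 0" and C: "\<And>k y. k < m \<Longrightarrow> y \<in> ?Y \<Longrightarrow> \<bar>\<phi> k y\<bar> \<le> C"
    unfolding bounded_pos by auto
  show "\<forall>\<^sub>F K in sequentially. \<forall>\<^sub>F T in sequentially.
    \<exists>(A :: nat \<Rightarrow> real mat) (B :: nat \<Rightarrow> real mat) (c :: nat \<Rightarrow> real Matrix.vec).
      (\<forall>d\<in>{1..D}. A d \<in> carrier_mat K T \<and> B d \<in> carrier_mat T (p d) \<and> c d \<in> carrier_vec T) \<and>
      (\<forall>d\<in>{1..D}. \<forall>e\<in>{1..D}. \<forall>x\<in>cube (p d) M. \<forall>x'\<in>cube (p e) M.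
         \<bar>g_star (f_star d x) (f_star e x') -
          scalar_prod
            (two_layer_network \<sigma> (A d) (B d) (c d) (Matrix.vec (p d) x))
            (two_layer_network \<sigma> (A e) (B e) (c e) (Matrix.vec (p e) x'))\<bar> < \<epsilon>)"
  proof (rule eventually_sequentiallyI)
    fix K
    assume "m \<le> K"
    \<comment> \<open>Zero features from \<open>m\<close> on leave the kernel sum unchanged, so
      every \<open>K \<ge> m\<close> is covered.\<close>
    define h where "h d k x = (if k < m then \<phi> k (f_star d x) else 0)" for d k x
    \<comment> \<open>Each of the \<open>K\<close> products has error at most
      \<open>\<delta> * (2 * C + 1)\<close>, so together they stay within
      \<open>\<epsilon> / 4\<close>. The minimum with \<open>1\<close> serves the product
      estimate.\<close>
    define \<delta> where "\<delta> = min 1 (\<epsilon> / (4 * (real K + 1) * (2 * C + 1)))"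
    have "\<delta> > 0" "\<delta> \<le> 1"
      using \<open>\<epsilon> > 0\<close> \<open>C > 0\<close> by (auto simp: \<delta>_def)
    have "\<delta> \<le> \<epsilon> / (4 * (real K + 1) * (2 * C + 1))"
      by (simp add: \<delta>_def)
    then have "\<delta> * (4 * (real K + 1) * (2 * C + 1)) \<le> \<epsilon>"
      using \<open>C > 0\<close> by (subst (asm) pos_le_divide_eq) auto
    then have "4 * ((real K + 1) * (\<delta> * (2 * C + 1))) \<le> \<epsilon>"
      by (simp add: algebra_simps)
    moreover have "real K * (\<delta> * (2 * C + 1)) \<le> (real K + 1) * (\<delta> * (2 * C + 1))"
      using \<open>\<delta> > 0\<close> \<open>C > 0\<close> by (intro mult_right_mono) auto
    ultimately have \<delta>: "real K * (\<delta> * (2 * C + 1)) < \<epsilon> / 2"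
      using \<open>\<epsilon> > 0\<close> by linarith
    have f_in: "f_star d x \<in> ?Y" if "d \<in> {1..D}" "x \<in> cube (p d) M" for d x
      using assms(3)[OF that(1)] that(2) by auto
    have h_bound: "\<bar>h d k x\<bar> \<le> C" if "d \<in> {1..D}" "x \<in> cube (p d) M" for d k x
      using C[OF _ f_in[OF that]] \<open>C > 0\<close> by (simp add: h_def)
    define is_approx where "is_approx T d A B c \<longleftrightarrow>
        A \<in> carrier_mat K T \<and> B \<in> carrier_mat T (p d) \<and> c \<in> carrier_vec T \<and>
        (\<forall>x\<in>cube (p d) M. \<forall>k<K.
          \<bar>h d k x - vec_index (two_layer_network \<sigma> A B c (Matrix.vec (p d) x)) k\<bar> < \<delta>)"
      for T d A B c
    have "\<forall>\<^sub>F T in sequentially. \<exists>A B c. is_approx T d A B c" if d: "d \<in> {1..D}" for d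
    proof -
      have "continuous_on (cube (p d) M) (h d k)" for k
      proof (cases "k < m")
        case True
        then show ?thesis
          using continuous_on_compose2[OF \<phi> assms(4)[OF d]] f_in[OF d]
          by (auto simp: h_def image_subset_iff)
      qed (simp add: h_def)
      moreover have "\<sigma> = relu \<or> (\<not> \<sigma> constant_on UNIV \<and> bounded (range \<sigma>) \<and> mono \<sigma>)"
        using assms(8) by blast
      ultimately have "\<forall>\<^sub>F T in sequentially.
          \<exists>A\<in>carrier_mat K T. \<exists>B\<in>carrier_mat T (p d). \<exists>c\<in>carrier_vec T.
          \<forall>x\<in>cube (p d) M. \<forall>k<K.
            \<bar>h d k x - vec_index (two_layer_network \<sigma> A B c (Matrix.vec (p d) x)) k\<bar> < \<delta>"
        using \<open>\<delta> > 0\<close> by (intro two_layer_network_universal_approximation)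
      then show ?thesis
        by eventually_elim (auto simp: is_approx_def)
    qed
    \<comment> \<open>As there are finitely many \<open>d\<close>, their thresholds for
      \<open>T\<close> have a common bound.\<close>
    then have "\<forall>\<^sub>F T in sequentially. \<forall>d\<in>{1..D}. \<exists>A B c. is_approx T d A B c"
      by (intro eventually_ball_finite) auto
    then show "\<forall>\<^sub>F T in sequentially.
      \<exists>(A :: nat \<Rightarrow> real mat) (B :: nat \<Rightarrow> real mat) (c :: nat \<Rightarrow> real Matrix.vec).
        (\<forall>d\<in>{1..D}. A d \<in> carrier_mat K T \<and> B d \<in> carrier_mat T (p d) \<and> c d \<in> carrier_vec T) \<and>
        (\<forall>d\<in>{1..D}. \<forall>e\<in>{1..D}. \<forall>x\<in>cube (p d) M. \<forall>x'\<in>cube (p e) M.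
           \<bar>g_star (f_star d x) (f_star e x') -
            scalar_prod
              (two_layer_network \<sigma> (A d) (B d) (c d) (Matrix.vec (p d) x))
              (two_layer_network \<sigma> (A e) (B e) (c e) (Matrix.vec (p e) x'))\<bar> < \<epsilon>)"
    proof eventually_elim
      case (elim T)
      then obtain A B c where ABc: "\<And>d. d \<in> {1..D} \<Longrightarrow> is_approx T d (A d) (B d) (c d)"
        by metis
      define N where "N d x = two_layer_network \<sigma> (A d) (B d) (c d) (Matrix.vec (p d) x)" for d x
      have N: "\<bar>h d k x - vec_index (N d x) k\<bar> \<le> \<delta>"
        if "d \<in> {1..D}" "x \<in> cube (p d) M" "k < K" for d x k
        using ABc[OF that(1)] that(2,3) by (auto simp: is_approx_def N_def intro: less_imp_le)
      have dim_N: "dim_vec (N d x) = K" if "d \<in> {1..D}" for d x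
        using ABc[OF that] by (auto simp: is_approx_def N_def two_layer_network_def)
      have "\<bar>g_star (f_star d x) (f_star e x') - scalar_prod (N d x) (N e x')\<bar> < \<epsilon>"
        if d: "d \<in> {1..D}" and e: "e \<in> {1..D}" and x: "x \<in> cube (p d) M" and x': "x' \<in> cube (p e) M"
        for d e x x'
      proof -
        have "(\<Sum>k<m. \<phi> k (f_star d x) * \<phi> k (f_star e x')) = (\<Sum>k<K. h d k x * h e k x')"
          using \<open>m \<le> K\<close> by (intro sum.mono_neutral_cong_left) (auto simp: h_def)
        moreover have "scalar_prod (N d x) (N e x') = (\<Sum>k<K. vec_index (N d x) k * vec_index (N e x') k)"
          by (simp add: scalar_prod_def dim_N[OF e] atLeast0LessThan)
        ultimately have "\<bar>(\<Sum>k<m. \<phi> k (f_star d x) * \<phi> k (f_star e x')) - scalar_prod (N d x) (N e x')\<bar>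
            = \<bar>\<Sum>k<K. h d k x * h e k x' - vec_index (N d x) k * vec_index (N e x') k\<bar>"
          by (simp add: sum_subtractf)
        also have "\<dots> \<le> (\<Sum>k<K. \<delta> * (2 * C + 1))"
          using d e x x' \<open>\<delta> \<le> 1\<close>
          by (intro sum_abs[THEN order_trans] sum_mono abs_mult_diff_le h_bound N) auto
        also have "\<dots> < \<epsilon> / 2"
          using \<delta> by simp
        finally show ?thesis
          using g_\<phi>[OF f_in[OF d x] f_in[OF e x']] by linarith
      qed
      then show ?case
        using ABc unfolding N_def is_approx_def
        by (intro exI[of _ A] exI[of _ B] exI[of _ c]) auto
    qed
  qed
qed

end
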